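(* Let $\langle F,E\rangle$ be a weak-* sequentially complete anti-dual pair and let $A,B\in\mathscr L(E;F)$ be positive operators. There exists a unique positive operator $A:B\in\mathscr L(E;F)$, called the parallel sum of $A$ and $B$, such that $$\langle(A:B)x,x\rangle=\inf\{\langle A(x-y),x-y\rangle+\langle By,y\rangle:\ y\in E\},\qquad x\in E.$$
   Context: An anti-dual pair $\langle F,E\rangle$ consists of complex vector spaces $E,F$ and a map $\langle\cdot,\cdot\rangle:F\times E\to\mathbb C$, linear in the first and conjugate linear in the second variable, that separates the points of $E$ and of $F$. $\sigma(F,E)$ is the weak topology on $F$ induced by the functionals $\langle\cdot,x\rangle$ ($x\in E$), and $\sigma(E,F)$ is the weak topology on $E$ induced by the functionals $\langle f,\cdot\rangle$ ($f\in F$). The pair is weak-* sequentially complete if every Cauchy sequence of $(F,\sigma(F,E))$ converges. $\mathscr L(E;F)$ is the set of $\sigma(E,F)$-$\sigma(F,E)$ continuous linear operators $E\to F$. A linear operator $A:E\to F$ is positive if $\langle Ax,x\rangle\ge0$ for all $x\in E$. *)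

theory Defs
  imports "HOL-Analysis.Analysis"
begin

text \<open>Complex vector spaces are given by an additive group type together with a complex scalar
  multiplication satisfying \<^locale>\<open>vector_space\<close>; the carriers are the whole types.\<close>

locale anti_dual_pair =
  F: vector_space scaleF + E: vector_space scaleE
  for scaleF :: "complex \<Rightarrow> 'f::ab_group_add \<Rightarrow> 'f"
    and scaleE :: "complex \<Rightarrow> 'e::ab_group_add \<Rightarrow> 'e" +
  fixes pair :: "'f \<Rightarrow> 'e \<Rightarrow> complex"
  assumes pair_add_left: "pair (f + g) x = pair f x + pair g x"
    and pair_scale_left: "pair (scaleF c f) x = c * pair f x"
    and pair_add_right: "pair f (x + y) = pair f x + pair f y"
    and pair_scale_right: "pair f (scaleE c x) = cnj c * pair f x"
    and separates_F: "f \<noteq> g \<Longrightarrow> \<exists>x. pair f x \<noteq> pair g x"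
    and separates_E: "x \<noteq> y \<Longrightarrow> \<exists>f. pair f x \<noteq> pair f y"

text \<open>The coarsest topology making all functions in the given set continuous.\<close>

definition weak_topology :: "('a \<Rightarrow> complex) set \<Rightarrow> 'a topology" where
  "weak_topology \<Phi> = topology_generated_by {\<phi> -` U |\<phi> U. \<phi> \<in> \<Phi> \<and> open U}"

definition sigma_F :: "('f \<Rightarrow> 'e \<Rightarrow> complex) \<Rightarrow> 'f topology" where
  "sigma_F pair = weak_topology (range (\<lambda>x f. pair f x))"

definition sigma_E :: "('f \<Rightarrow> 'e \<Rightarrow> complex) \<Rightarrow> 'e topology" where
  "sigma_E pair = weak_topology (range (\<lambda>f x. pair f x))"

text \<open>Cauchy sequences with respect to the translation-invariant uniformity of a group topology.\<close>

definition Cauchy_seq_in :: "'a::ab_group_add topology \<Rightarrow> (nat \<Rightarrow> 'a) \<Rightarrow> bool" where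
  "Cauchy_seq_in T s \<longleftrightarrow>
    (\<forall>U. openin T U \<and> 0 \<in> U \<longrightarrow> (\<exists>N. \<forall>m\<ge>N. \<forall>n\<ge>N. s m - s n \<in> U))"

definition weak_star_sequentially_complete :: "('f::ab_group_add \<Rightarrow> 'e \<Rightarrow> complex) \<Rightarrow> bool" where
  "weak_star_sequentially_complete pair \<longleftrightarrow>
    (\<forall>s. Cauchy_seq_in (sigma_F pair) s \<longrightarrow> (\<exists>l. limitin (sigma_F pair) s l sequentially))"

definition weakly_continuous_operators ::
  "(complex \<Rightarrow> 'f::ab_group_add \<Rightarrow> 'f) \<Rightarrow> (complex \<Rightarrow> 'e::ab_group_add \<Rightarrow> 'e)
    \<Rightarrow> ('f \<Rightarrow> 'e \<Rightarrow> complex) \<Rightarrow> ('e \<Rightarrow> 'f) set" where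
  "weakly_continuous_operators scaleF scaleE pair =
    {A. Vector_Spaces.linear scaleE scaleF A \<and> continuous_map (sigma_E pair) (sigma_F pair) A}"

text \<open>Positivity includes that the complex number \<open>pair (A x) x\<close> is real. Linearity is not part
  of this predicate.\<close>

definition positive_operator :: "('f \<Rightarrow> 'e \<Rightarrow> complex) \<Rightarrow> ('e \<Rightarrow> 'f) \<Rightarrow> bool" where
  "positive_operator pair A \<longleftrightarrow> (\<forall>x. pair (A x) x \<in> \<real>\<^sub>\<ge>\<^sub>0)"

end

theory Submission
  imports Defs
begin

text \<open>Let \<open>a\<close>, \<open>b\<close> be the forms of \<open>A\<close>, \<open>B\<close> and \<open>s = a + b\<close>. For fixed \<open>x\<close>, a point \<open>y\<close> minimises
  \<open>a (x - y) (x - y) + b y y\<close> up to \<open>e\<^sup>2\<close> iff \<open>\<bar>a x z - s y z\<bar> \<le> e * sqrt (s z z)\<close> for all \<open>z\<close>,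
  a condition that is linear in \<open>(x, y)\<close>. It makes every minimising sequence \<open>y n\<close> Cauchy for the
  seminorm of \<open>s\<close>, so \<open>A (x - y n)\<close> is weak-* Cauchy; its limit is the value of the parallel sum
  at \<open>x\<close>, and does not depend on the sequence. Linearity is inherited from the condition, and weak
  continuity is automatic because positive operators are symmetric.\<close>

section \<open>Positive sesquilinear forms\<close>

text \<open>Polarization: the diagonal at \<open>u + v\<close> gives
  \<open>h u v + h v u = 0\<close>, and replacing \<open>y\<close> by \<open>i y\<close> flips the
  relative sign of the two terms, so both vanish.\<close>

lemma sesquilinear_eq_zeroI:
  fixes scale :: "complex \<Rightarrow> 'e::ab_group_add \<Rightarrow> 'e" and h :: "'e \<Rightarrow> 'e \<Rightarrow> complex"
  assumes add_left: "\<And>x y z. h (x + y) z = h x z + h y z"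
    and scale_left: "\<And>c x z. h (scale c x) z = c * h x z"
    and add_right: "\<And>x y z. h x (y + z) = h x y + h x z"
    and scale_right: "\<And>c x z. h x (scale c z) = cnj c * h x z"
    and diag: "\<And>x. h x x = 0"
  shows "h x y = 0"
proof -
  have cross: "h u v + h v u = 0" for u v
  proof -
    have "h (u + v) (u + v) = h u u + (h u v + h v u) + h v v"
      by (simp add: add_left add_right)
    then show ?thesis
      by (simp only: diag) simp
  qed
  have "\<i> * h y x - \<i> * h x y = 0"
    using cross[of x "scale \<i> y"] by (simp add: scale_left scale_right)
  then have "h y x = h x y"
    by simp
  with cross[of x y] show ?thesis
    by simp
qed

text \<open>The hypothesis bounds a quadratic in \<open>t\<close> from below, and the best
  \<open>t\<close> is a real multiple of \<open>r\<close>. This serves twice: for Cauchy-Schwarz,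
  and to turn near-minimality of the energy into a bound on its first variation.\<close>

lemma discriminant_bound:
  fixes r :: complex and s d :: real
  assumes s: "0 \<le> s" and d: "0 \<le> d"
    and le: "\<And>t :: complex. 2 * Re (cnj t * r) \<le> (cmod t)\<^sup>2 * s + d"
  shows "cmod r \<le> sqrt d * sqrt s"
proof -
  have le': "2 * u * (cmod r)\<^sup>2 \<le> u\<^sup>2 * (cmod r)\<^sup>2 * s + d" for u :: real
  proof -
    have "cnj (complex_of_real u * r) * r = complex_of_real (u * (cmod r)\<^sup>2)"
      by (simp only: complex_norm_square of_real_mult complex_cnj_mult complex_cnj_complex_of_real)
        (simp add: mult_ac)
    then have "Re (cnj (complex_of_real u * r) * r) = u * (cmod r)\<^sup>2"
      by (simp only: Re_complex_of_real)
    then show ?thesis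
      using le[of "of_real u * r"] by (simp only: norm_mult power_mult_distrib) simp
  qed
  have "(cmod r)\<^sup>2 \<le> d * s"
  proof (cases "s = 0")
    case True
    have "(cmod r)\<^sup>2 = 0"
    proof (rule ccontr)
      assume nz: "(cmod r)\<^sup>2 \<noteq> 0"
      \<comment> \<open>For \<open>s = 0\<close> the right side is the constant \<open>d\<close>;
        this \<open>u\<close> makes the left side \<open>2 * (d + 1)\<close>, which exceeds
        it.\<close>
      have "2 * ((d + 1) / (cmod r)\<^sup>2) * (cmod r)\<^sup>2 \<le> d"
        using le'[of "(d + 1) / (cmod r)\<^sup>2"] True by simp
      then have "2 * (d + 1) \<le> d"
        using nz by simp
      then show False
        using d by simp
    qed
    then show ?thesis
      using True by simp
  next
    case False
    then have "s > 0"
      using s by simp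
    \<comment> \<open>The value \<open>u = 1 / s\<close> minimises the quadratic in
      \<open>u\<close>.\<close>
    have "2 * (1 / s) * (cmod r)\<^sup>2 \<le> (1 / s)\<^sup>2 * (cmod r)\<^sup>2 * s + d"
      by (rule le')
    then show ?thesis
      using \<open>s > 0\<close> by (simp add: field_simps power2_eq_square)
  qed
  then show ?thesis
    by (metis real_le_rsqrt real_sqrt_mult)
qed

locale positive_form = vector_space scale
  for scale :: "complex \<Rightarrow> 'e::ab_group_add \<Rightarrow> 'e" +
  fixes h :: "'e \<Rightarrow> 'e \<Rightarrow> complex"
  assumes add_left: "h (x + y) z = h x z + h y z"
    and scale_left: "h (scale c x) z = c * h x z"
    and add_right: "h x (y + z) = h x y + h x z"
    and scale_right: "h x (scale c z) = cnj c * h x z"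
    and nonneg: "h x x \<in> \<real>\<^sub>\<ge>\<^sub>0"
begin

definition snorm :: "'e \<Rightarrow> real" where
  "snorm x = sqrt (Re (h x x))"

lemma diff_left: "h (x - y) z = h x z - h y z"
  using add_left[of "x - y" y z] by simp

lemma zero_left [simp]: "h 0 z = 0"
  using add_left[of 0 0 z] by simp

lemma diff_right: "h x (y - z) = h x y - h x z"
  using add_right[of x "y - z" z] by simp

lemma Re_nonneg: "0 \<le> Re (h x x)"
  using nonneg[of x] by (auto simp: complex_nonneg_Reals_iff)

lemma snorm_nonneg [simp]: "0 \<le> snorm x"
  by (simp add: snorm_def Re_nonneg)

lemma Re_eq_snorm: "Re (h x x) = (snorm x)\<^sup>2"
  by (simp add: snorm_def Re_nonneg)

lemma diagonal_eq_snorm: "h x x = of_real ((snorm x)\<^sup>2)"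
  using nonneg[of x] by (simp add: complex_eq_iff complex_nonneg_Reals_iff flip: Re_eq_snorm)

text \<open>The defect \<open>h x y - cnj (h y x)\<close> is again sesquilinear, and it vanishes on
  the diagonal because \<open>h x x\<close> is real.\<close>

lemma hermitian: "h y x = cnj (h x y)"
proof -
  have "h x y - cnj (h y x) = 0"
    by (rule sesquilinear_eq_zeroI[where scale = scale and h = "\<lambda>x y. h x y - cnj (h y x)"])
      (simp_all add: add_left add_right scale_left scale_right diagonal_eq_snorm right_diff_distrib)
  then show ?thesis
    by (metis complex_cnj_cnj eq_iff_diff_eq_0)
qed

lemma Re_diff_diagonal:
  "Re (h (x - y) (x - y)) = Re (h x x) - 2 * Re (h x y) + Re (h y y)"
  using arg_cong[OF hermitian[of x y], of Re]
  by (simp add: diff_left diff_right)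

lemma Re_add_diagonal:
  "Re (h (x + y) (x + y)) = Re (h x x) + 2 * Re (h x y) + Re (h y y)"
  using arg_cong[OF hermitian[of x y], of Re]
  by (simp add: add_left add_right)

lemma Re_diagonal_scale: "Re (h (scale t y) (scale t y)) = (cmod t)\<^sup>2 * Re (h y y)"
proof -
  have "h (scale t y) (scale t y) = (t * cnj t) * h y y"
    by (simp add: scale_left scale_right)
  also have "\<dots> = of_real ((cmod t)\<^sup>2) * h y y"
    by (simp only: complex_norm_square)
  finally show ?thesis
    by simp
qed

text \<open>Nonnegativity of \<open>h\<close> at \<open>x - t y\<close> for all complex
  \<open>t\<close>; degenerate forms are covered, since the discriminant bound allows
  \<open>s = 0\<close>.\<close>

lemma Cauchy_Schwarz: "cmod (h x y) \<le> snorm x * snorm y"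
  unfolding snorm_def
proof (rule discriminant_bound)
  fix t :: complex
  show "2 * Re (cnj t * h x y) \<le> (cmod t)\<^sup>2 * Re (h y y) + Re (h x x)"
    using Re_nonneg[of "x - scale t y"] Re_diff_diagonal[of x "scale t y"] Re_diagonal_scale[of t y]
    by (simp add: scale_right)
qed (simp_all add: Re_nonneg)

lemma snorm_scale_sq: "(snorm (scale t y))\<^sup>2 = (cmod t)\<^sup>2 * (snorm y)\<^sup>2"
  using Re_diagonal_scale[of t y] by (simp add: Re_eq_snorm)

end

section \<open>Approximate minimisers\<close>

locale positive_form_pair =
  a: positive_form scale a + b: positive_form scale b
  for scale :: "complex \<Rightarrow> 'e::ab_group_add \<Rightarrow> 'e" and a b
begin

definition s :: "'e \<Rightarrow> 'e \<Rightarrow> complex" where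
  "s x y = a x y + b x y"

sublocale s: positive_form scale s
  by unfold_locales
    (auto simp: s_def a.add_left b.add_left a.add_right b.add_right a.scale_left b.scale_left
      a.scale_right b.scale_right algebra_simps intro: nonneg_Reals_add_I a.nonneg b.nonneg)

lemma a_snorm_le: "a.snorm x \<le> s.snorm x"
  by (simp add: a.snorm_def s.snorm_def s_def b.Re_nonneg)

definition energy :: "'e \<Rightarrow> 'e \<Rightarrow> real" where
  "energy x y = Re (a (x - y) (x - y) + b y y)"

definition par_form :: "'e \<Rightarrow> real" where
  "par_form x = (INF y. energy x y)"

lemma energy_nonneg: "0 \<le> energy x y"
  by (simp add: energy_def a.Re_nonneg b.Re_nonneg)

lemma par_form_le: "par_form x \<le> energy x y"
  unfolding par_form_def by (rule cINF_lower) (auto intro: bdd_belowI energy_nonneg)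

lemma par_form_greatest: "(\<And>y. c \<le> energy x y) \<Longrightarrow> c \<le> par_form x"
  unfolding par_form_def by (rule cINF_greatest) auto

text \<open>Exact second-order expansion of the energy at \<open>y\<close>: the linear term is the
  Euler-Lagrange residual, the quadratic term the seminorm of \<open>s\<close>.\<close>

lemma energy_shift: "energy x (y + w) = energy x y - 2 * Re (a x w - s y w) + (s.snorm w)\<^sup>2"
proof -
  have "energy x (y + w) = Re (a (x - y) (x - y)) - 2 * Re (a (x - y) w) + Re (a w w)
      + (Re (b y y) + 2 * Re (b y w) + Re (b w w))"
    using a.Re_diff_diagonal[of "x - y" w] b.Re_add_diagonal[of y w]
    by (simp add: energy_def diff_diff_add)
  then show ?thesis
    by (simp add: energy_def a.diff_left[of x y w] s_def flip: s.Re_eq_snorm)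
qed

text \<open>The Euler--Lagrange equation \<open>a x \<cdot> = s y \<cdot>\<close> of \<open>energy x\<close>, up to an error \<open>e\<close>
  in the norm dual to \<open>s.snorm\<close>.\<close>

definition approx_min :: "real \<Rightarrow> 'e \<Rightarrow> 'e \<Rightarrow> bool" where
  "approx_min e x y \<longleftrightarrow> (\<forall>z. cmod (a x z - s y z) \<le> e * s.snorm z)"

lemma approx_minD: "approx_min e x y \<Longrightarrow> cmod (a x z - s y z) \<le> e * s.snorm z"
  by (simp add: approx_min_def)

text \<open>A point within \<open>e\<^sup>2\<close> of the infimum works: comparing its energy with
  that at \<open>y + t z\<close> for all \<open>t\<close> bounds the residual by the square root of
  the slack.\<close>

lemma approx_min_exists:
  assumes "e > 0"
  shows "\<exists>y. approx_min e x y"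
proof -
  have "\<exists>y. energy x y < par_form x + e\<^sup>2"
    using par_form_greatest[of "par_form x + e\<^sup>2" x] assms
    by (metis add_le_same_cancel1 linorder_not_le zero_less_power)
  then obtain y where y: "energy x y < par_form x + e\<^sup>2" ..
  have "cmod (a x z - s y z) \<le> sqrt (e\<^sup>2) * sqrt ((s.snorm z)\<^sup>2)" for z
  proof (rule discriminant_bound)
    fix t
    show "2 * Re (cnj t * (a x z - s y z)) \<le> (cmod t)\<^sup>2 * (s.snorm z)\<^sup>2 + e\<^sup>2"
      using y par_form_le[of x "y + scale t z"] energy_shift[of x y "scale t z"]
      by (simp add: a.scale_right s.scale_right s.snorm_scale_sq right_diff_distrib)
  qed simp_all
  then show ?thesis
    using assms by (auto simp: approx_min_def)
qed

text \<open>Converse of the construction in \<open>approx_min_exists\<close>: a small residual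
  forces near-minimality.\<close>

lemma approx_min_energy_le:
  assumes "approx_min e x y"
  shows "energy x y \<le> par_form x + e\<^sup>2"
proof -
  have "energy x y - e\<^sup>2 \<le> energy x y'" for y'
  proof -
    let ?w = "y' - y"
    have "Re (a x ?w - s y ?w) \<le> e * s.snorm ?w"
      using approx_minD[OF assms] complex_Re_le_cmod order_trans by blast
    \<comment> \<open>Completing the square: moving by \<open>?w\<close> gains at most
      \<open>2 * e * s.snorm ?w\<close> and costs \<open>(s.snorm ?w)\<^sup>2\<close>, a net gain of
      at most \<open>e\<^sup>2\<close>.\<close>
    moreover have "0 \<le> (e - s.snorm ?w)\<^sup>2"
      by simp
    ultimately show ?thesis
      using energy_shift[of x y ?w] by (simp add: power2_diff)
  qed
  from par_form_greatest[OF this] show ?thesis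
    by simp
qed

text \<open>The residual \<open>a x z - s y z\<close> is linear in \<open>(x, y)\<close> jointly.
  This and \<open>approx_min_scale\<close> are the source of the linearity of the parallel
  sum.\<close>

lemma approx_min_add:
  assumes "approx_min e x y" "approx_min e' x' y'"
  shows "approx_min (e + e') (x + x') (y + y')"
  unfolding approx_min_def
proof
  fix z
  have "cmod ((a x z - s y z) + (a x' z - s y' z)) \<le> e * s.snorm z + e' * s.snorm z"
    by (rule norm_triangle_le, rule add_mono) (use assms approx_minD in auto)
  then show "cmod (a (x + x') z - s (y + y') z) \<le> (e + e') * s.snorm z"
    by (simp add: a.add_left s.add_left algebra_simps)
qed

lemma approx_min_scale:
  assumes "approx_min e x y"
  shows "approx_min (cmod c * e) (scale c x) (scale c y)"
  unfolding approx_min_def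
proof
  fix z
  have "cmod (c * (a x z - s y z)) \<le> cmod c * (e * s.snorm z)"
    unfolding norm_mult by (rule mult_left_mono) (use assms approx_minD in auto)
  then show "cmod (a (scale c x) z - s (scale c y) z) \<le> cmod c * e * s.snorm z"
    by (simp add: a.scale_left s.scale_left algebra_simps)
qed

text \<open>The residual is tested at \<open>z = y\<close> and one factor \<open>s.snorm y\<close>
  is cancelled. The \<open>max\<close> admits a negative \<open>e\<close>, which can occur only if
  \<open>s.snorm\<close> vanishes identically.\<close>

lemma approx_min_zero_snorm:
  assumes "approx_min e 0 y"
  shows "s.snorm y \<le> max e 0"
proof (cases "s.snorm y = 0")
  case False
  have "cmod (s y y) \<le> e * s.snorm y"
    using approx_minD[OF assms, of y] by simp
  then have "s.snorm y * s.snorm y \<le> e * s.snorm y"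
    by (simp add: s.diagonal_eq_snorm norm_power power2_eq_square norm_mult)
  then show ?thesis
    using False s.snorm_nonneg[of y] by simp
qed simp

text \<open>By linearity \<open>y - y'\<close> is an approximate minimiser for \<open>0\<close>,
  hence small in \<open>s.snorm\<close> and so in \<open>a.snorm\<close>. The bound depends on the
  errors alone, which yields both convergence and independence of the sequence.\<close>

lemma approx_min_cauchy:
  assumes "approx_min e x y" "approx_min e' x y'"
  shows "cmod (a (y - y') z) \<le> max (e + e') 0 * a.snorm z"
proof -
  have "approx_min (cmod (-1) * e') (scale (-1) x) (scale (-1) y')"
    by (rule approx_min_scale) fact
  from approx_min_add[OF assms(1) this] have "approx_min (e + e') 0 (y - y')"
    by simp
  from approx_min_zero_snorm[OF this] have "a.snorm (y - y') \<le> max (e + e') 0"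
    using a_snorm_le order_trans by blast
  then show ?thesis
    using a.Cauchy_Schwarz[of "y - y'" z] by (meson a.snorm_nonneg mult_right_mono order_trans)
qed

text \<open>Testing at \<open>z = y\<close> again, now with Cauchy-Schwarz for \<open>a\<close>. The
  bound is uniform along a minimising sequence for fixed \<open>x\<close>, as needed in
  \<open>approx_min_par_form\<close>.\<close>

lemma approx_min_snorm_le:
  assumes "approx_min e x y" "e \<ge> 0"
  shows "s.snorm y \<le> a.snorm x + e"
proof (cases "s.snorm y = 0")
  case False
  have "cmod (s y y) \<le> cmod (a x y) + cmod (a x y - s y y)"
    by (metis norm_minus_commute norm_triangle_sub)
  also have "\<dots> \<le> a.snorm x * s.snorm y + e * s.snorm y"
    by (intro add_mono order_trans[OF a.Cauchy_Schwarz] mult_left_mono a_snorm_le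
        approx_minD assms a.snorm_nonneg)
  finally have "s.snorm y * s.snorm y \<le> (a.snorm x + e) * s.snorm y"
    by (simp add: s.diagonal_eq_snorm norm_power power2_eq_square norm_mult algebra_simps)
  then show ?thesis
    using False s.snorm_nonneg[of y] by simp
qed (use assms in simp)

lemma approx_min_par_form:
  assumes "approx_min e x y" "e \<ge> 0"
  shows "cmod (a (x - y) x - of_real (par_form x)) \<le> e * (a.snorm x + e) + e\<^sup>2"
proof -
  have "of_real (energy x y) = a (x - y) (x - y) + b y y"
    by (simp add: energy_def a.diagonal_eq_snorm b.diagonal_eq_snorm)
  \<comment> \<open>Splitting the second argument \<open>x\<close> as \<open>(x - y) + y\<close>
    leaves the residual tested at \<open>y\<close> plus the excess of the energy over its infimum;
    each is controlled by \<open>e\<close>.\<close>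
  then have "a (x - y) x - of_real (par_form x)
      = (a x y - s y y) + of_real (energy x y - par_form x)"
    by (simp add: s_def a.diff_left a.diff_right)
  also have "cmod \<dots> \<le> e * s.snorm y + e\<^sup>2"
    using approx_min_energy_le[OF assms(1)] par_form_le[of x y]
    by (intro norm_triangle_le add_mono approx_minD assms) (auto simp del: of_real_diff)
  also have "\<dots> \<le> e * (a.snorm x + e) + e\<^sup>2"
    using assms by (simp add: approx_min_snorm_le mult_left_mono)
  finally show ?thesis .
qed

end

section \<open>The weak topologies\<close>

lemma openin_weak_topology_basis:
  "\<phi> \<in> \<Phi> \<Longrightarrow> open U \<Longrightarrow> openin (weak_topology \<Phi>) (\<phi> -` U)"
  unfolding weak_topology_def by (rule topology_generated_by_Basis) blast

lemma topspace_weak_topology: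
  assumes "\<Phi> \<noteq> {}"
  shows "topspace (weak_topology \<Phi>) = UNIV"
proof -
  obtain \<phi> where "\<phi> \<in> \<Phi>"
    using assms by blast
  then have "openin (weak_topology \<Phi>) (\<phi> -` UNIV)"
    by (rule openin_weak_topology_basis) simp
  then show ?thesis
    using openin_subset by fastforce
qed

text \<open>The conjugate is there because a hermitian form swaps its arguments up to conjugation;
  \<open>cnj\<close> is continuous, so preimages of open sets stay open.\<close>

lemma continuous_map_weak_topology:
  assumes "\<Phi> \<noteq> {}" "\<Psi> \<noteq> {}" and "\<And>\<psi>. \<psi> \<in> \<Psi> \<Longrightarrow> \<exists>\<phi>\<in>\<Phi>. \<forall>x. \<psi> (T x) = cnj (\<phi> x)"
  shows "continuous_map (weak_topology \<Phi>) (weak_topology \<Psi>) T"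
  unfolding weak_topology_def[of \<Psi>]
proof (rule continuous_on_generated_topo)
  fix V assume "V \<in> {\<psi> -` U |\<psi> U. \<psi> \<in> \<Psi> \<and> open U}"
  then obtain \<psi> U where V: "V = \<psi> -` U" "\<psi> \<in> \<Psi>" "open U"
    by blast
  obtain \<phi> where \<phi>: "\<phi> \<in> \<Phi>" "\<And>x. \<psi> (T x) = cnj (\<phi> x)"
    using assms(3)[OF V(2)] by blast
  have "T -` V = \<phi> -` (cnj -` U)"
    by (auto simp: V \<phi>)
  moreover have "open (cnj -` U)"
    by (intro open_vimage V continuous_intros)
  ultimately show "openin (weak_topology \<Phi>) (T -` V \<inter> topspace (weak_topology \<Phi>))"
    using openin_weak_topology_basis[OF \<phi>(1)] topspace_weak_topology[OF assms(1)] by simp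
next
  show "T ` topspace (weak_topology \<Phi>) \<subseteq> \<Union> {\<psi> -` U |\<psi> U. \<psi> \<in> \<Psi> \<and> open U}"
    using assms(2) by (auto intro!: exI[of _ UNIV])
qed

lemma limitin_weak_topologyD:
  assumes "limitin (weak_topology \<Phi>) u l F" "\<phi> \<in> \<Phi>"
  shows "((\<lambda>n. \<phi> (u n)) \<longlongrightarrow> \<phi> l) F"
proof (rule topological_tendstoI)
  fix S assume "open S" "\<phi> l \<in> S"
  then show "\<forall>\<^sub>F n in F. \<phi> (u n) \<in> S"
    using assms openin_weak_topology_basis[OF assms(2)] unfolding limitin_def by fastforce
qed

text \<open>Induction on how a neighbourhood of \<open>0\<close> is generated: intersections take
  the larger index, a union uses the member containing \<open>0\<close>, and additivity settles the
  subbasic sets.\<close>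

lemma Cauchy_seq_in_weak_topologyI:
  fixes u :: "nat \<Rightarrow> 'a::ab_group_add"
  assumes diff: "\<And>\<phi> x y. \<phi> \<in> \<Phi> \<Longrightarrow> \<phi> (x - y) = \<phi> x - \<phi> y"
    and Cauchy: "\<And>\<phi>. \<phi> \<in> \<Phi> \<Longrightarrow> Cauchy (\<lambda>n. \<phi> (u n))"
  shows "Cauchy_seq_in (weak_topology \<Phi>) u"
  unfolding Cauchy_seq_in_def
proof (intro allI impI, elim conjE)
  fix U :: "'a set"
  assume "openin (weak_topology \<Phi>) U" "0 \<in> U"
  then have "generate_topology_on {\<phi> -` U |\<phi> U. \<phi> \<in> \<Phi> \<and> open U} U"
    by (simp add: weak_topology_def openin_topology_generated_by_iff)
  then show "\<exists>N. \<forall>m\<ge>N. \<forall>n\<ge>N. u m - u n \<in> U"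
    using \<open>0 \<in> U\<close>
  proof induction
    case (Int V W)
    then obtain N M where "\<forall>m\<ge>N. \<forall>n\<ge>N. u m - u n \<in> V" "\<forall>m\<ge>M. \<forall>n\<ge>M. u m - u n \<in> W"
      by auto
    then show ?case
      by (intro exI[of _ "max N M"]) auto
  next
    case (UN K)
    then show ?case
      by (metis UnionE UnionI)
  next
    case (Basis V)
    then obtain \<phi> S where V: "V = \<phi> -` S" "\<phi> \<in> \<Phi>" "open S"
      by blast
    have "\<phi> 0 = 0"
      using diff[OF V(2), of 0 0] by simp
    then obtain e where e: "e > 0" "ball 0 e \<subseteq> S"
      using Basis V openE by (metis vimageE)
    from Cauchy[OF V(2)] e(1) obtain N where "\<forall>m\<ge>N. \<forall>n\<ge>N. norm (\<phi> (u m) - \<phi> (u n)) < e"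
      by (meson CauchyD)
    then show ?case
      using e(2) by (auto simp: V diff subset_iff)
  qed simp
qed

section \<open>Operators of an anti-dual pair and their forms\<close>

context anti_dual_pair
begin

lemma pair_diff_left: "pair (f - g) x = pair f x - pair g x"
  using pair_add_left[of "f - g" g x] by simp

lemma pair_zero_left [simp]: "pair 0 x = 0"
  using pair_add_left[of 0 0 x] by simp

lemma eq_if_pair_eq: "(\<And>x. pair f x = pair g x) \<Longrightarrow> f = g"
  using separates_F by blast

text \<open>The form in which completeness is applied: a pointwise limit of functionals from
  \<open>F\<close> is again represented by an element of \<open>F\<close>.\<close>

lemma weak_star_limit:
  assumes "weak_star_sequentially_complete pair" "\<And>x. Cauchy (\<lambda>n. pair (u n) x)"
  shows "\<exists>l. \<forall>x. (\<lambda>n. pair (u n) x) \<longlonglongrightarrow> pair l x"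
proof -
  have "Cauchy_seq_in (sigma_F pair) u"
    unfolding sigma_F_def
    by (rule Cauchy_seq_in_weak_topologyI) (auto simp: pair_diff_left assms(2))
  then obtain l where "limitin (sigma_F pair) u l sequentially"
    using assms(1) by (auto simp: weak_star_sequentially_complete_def)
  then show ?thesis
    unfolding sigma_F_def using limitin_weak_topologyD[of _ u l sequentially "\<lambda>f. pair f x" for x]
    by blast
qed

lemma positive_form_operator:
  assumes "Vector_Spaces.linear scaleE scaleF T" "positive_operator pair T"
  shows "positive_form scaleE (\<lambda>x. pair (T x))"
proof -
  interpret T: Vector_Spaces.linear scaleE scaleF T by fact
  show ?thesis
    using assms(2)
    by unfold_locales
      (auto simp: T.add T.scale pair_add_left pair_scale_left pair_add_right pair_scale_right
        positive_operator_def)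
qed

text \<open>Symmetry: the functional of \<open>y\<close> on \<open>F\<close>, composed with
  \<open>T\<close>, is the conjugate of the functional of \<open>T y\<close> on
  \<open>E\<close>.\<close>

lemma positive_operator_weakly_continuous:
  assumes "Vector_Spaces.linear scaleE scaleF T" "positive_operator pair T"
  shows "T \<in> weakly_continuous_operators scaleF scaleE pair"
proof -
  interpret T: positive_form scaleE "\<lambda>x. pair (T x)"
    by (rule positive_form_operator[OF assms])
  have "\<exists>\<phi>\<in>range (\<lambda>f x. pair f x). \<forall>x. \<psi> (T x) = cnj (\<phi> x)"
    if \<psi>: "\<psi> \<in> range (\<lambda>x f. pair f x)" for \<psi>
  proof -
    obtain y where "\<psi> = (\<lambda>f. pair f y)"
      using \<psi> by blast
    then show ?thesis
      by (intro bexI[of _ "pair (T y)"]) (simp_all add: T.hermitian[of _ y])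
  qed
  then show ?thesis
    using assms(1) unfolding weakly_continuous_operators_def sigma_E_def sigma_F_def
    by (intro CollectI conjI continuous_map_weak_topology) blast+
qed

text \<open>Polarization applied to the difference of the two forms, followed by separation of the
  points of \<open>F\<close>.\<close>

lemma linear_eqI:
  assumes "Vector_Spaces.linear scaleE scaleF S" "Vector_Spaces.linear scaleE scaleF T"
    and eq: "\<And>x. pair (S x) x = pair (T x) x"
  shows "S = T"
proof (intro ext eq_if_pair_eq)
  interpret S: Vector_Spaces.linear scaleE scaleF S by fact
  interpret T: Vector_Spaces.linear scaleE scaleF T by fact
  fix x y
  have "pair (S x) y - pair (T x) y = 0"
    by (rule sesquilinear_eq_zeroI[where scale = scaleE and h = "\<lambda>x y. pair (S x) y - pair (T x) y"])
      (simp_all add: S.add T.add S.scale T.scale pair_add_left pair_scale_left pair_add_right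
        pair_scale_right eq right_diff_distrib)
  then show "pair (S x) y = pair (T x) y"
    by simp
qed

end

section \<open>The parallel sum\<close>

locale parallel_sum = anti_dual_pair scaleF scaleE pair
  for scaleF :: "complex \<Rightarrow> 'f::ab_group_add \<Rightarrow> 'f"
    and scaleE :: "complex \<Rightarrow> 'e::ab_group_add \<Rightarrow> 'e"
    and pair :: "'f \<Rightarrow> 'e \<Rightarrow> complex" +
  fixes A B :: "'e \<Rightarrow> 'f"
  assumes complete: "weak_star_sequentially_complete pair"
    and A_lin: "Vector_Spaces.linear scaleE scaleF A" and A_pos: "positive_operator pair A"
    and B_lin: "Vector_Spaces.linear scaleE scaleF B" and B_pos: "positive_operator pair B"
begin

sublocale positive_form_pair scaleE "\<lambda>x. pair (A x)" "\<lambda>x. pair (B x)"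
  unfolding positive_form_pair_def
  using positive_form_operator[OF A_lin A_pos] positive_form_operator[OF B_lin B_pos] by blast

text \<open>A relation over all admissible sequences, rather than one chosen sequence for each
  \<open>x\<close>, is closed under sums and scalar multiples; arbitrary null sequences
  \<open>e\<close> are allowed because these operations change the errors.\<close>

definition par_graph :: "'e \<Rightarrow> 'f \<Rightarrow> bool" where
  "par_graph x c \<longleftrightarrow> (\<exists>y e. e \<longlonglongrightarrow> 0 \<and> (\<forall>n. 0 \<le> e n \<and> approx_min (e n) x (y n)) \<and>
    (\<forall>z. (\<lambda>n. pair (A (x - y n)) z) \<longlonglongrightarrow> pair c z))"

lemma par_graph_exists: "\<exists>c. par_graph x c"
proof -
  \<comment> \<open>\<open>Suc n\<close> keeps the error positive at \<open>n = 0\<close>, as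
    \<open>approx_min_exists\<close> requires.\<close>
  let ?e = "\<lambda>n. 1 / real (Suc n)"
  have "\<forall>n. \<exists>y. approx_min (?e n) x y"
    by (intro allI approx_min_exists) simp
  then obtain y where y: "\<And>n. approx_min (?e n) x (y n)"
    by metis
  have e0: "?e \<longlonglongrightarrow> 0"
    using lim_inverse_n' LIMSEQ_Suc by blast
  have "Cauchy (\<lambda>n. pair (A (x - y n)) z)" for z
  proof (rule metric_CauchyI)
    fix r :: real assume "r > 0"
    let ?K = "a.snorm z"
    \<comment> \<open>The factor 2 accounts for the errors of \<open>y m\<close> and
      \<open>y n\<close>, each at most \<open>?e N\<close>.\<close>
    have "(\<lambda>n. ?e n * (2 * ?K)) \<longlonglongrightarrow> 0 * (2 * ?K)"
      by (intro tendsto_mult e0 tendsto_const)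
    then have "\<forall>\<^sub>F n in sequentially. ?e n * (2 * ?K) < r"
      by (rule order_tendstoD) (simp add: \<open>r > 0\<close>)
    then obtain N where N: "?e N * (2 * ?K) < r"
      by (meson eventually_sequentially order_refl)
    have "dist (pair (A (x - y m)) z) (pair (A (x - y n)) z) < r" if "m \<ge> N" "n \<ge> N" for m n
    proof -
      have "dist (pair (A (x - y m)) z) (pair (A (x - y n)) z) = cmod (pair (A (y n - y m)) z)"
        by (simp add: dist_norm a.diff_left)
      also have "\<dots> \<le> max (?e n + ?e m) 0 * ?K"
        by (rule approx_min_cauchy[OF y y])
      also have "\<dots> \<le> (?e N + ?e N) * ?K"
        using that by (intro mult_right_mono max.boundedI add_mono) (auto simp: frac_le)
      finally show ?thesis
        using N by simp
    qed
    then show "\<exists>N. \<forall>m\<ge>N. \<forall>n\<ge>N.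
        dist (pair (A (x - y m)) z) (pair (A (x - y n)) z) < r"
      by blast
  qed
  from weak_star_limit[OF complete this]
  obtain c where "\<forall>z. (\<lambda>n. pair (A (x - y n)) z) \<longlonglongrightarrow> pair c z" ..
  then have "par_graph x c"
    unfolding par_graph_def using y e0 by (intro exI[of _ y] exI[of _ ?e]) simp
  then show ?thesis ..
qed

lemma par_graph_add:
  assumes "par_graph x c" "par_graph x' c'"
  shows "par_graph (x + x') (c + c')"
proof -
  obtain y e where 1: "e \<longlonglongrightarrow> 0" "\<And>n. 0 \<le> e n" "\<And>n. approx_min (e n) x (y n)"
    "\<And>z. (\<lambda>n. pair (A (x - y n)) z) \<longlonglongrightarrow> pair c z"
    using assms(1) unfolding par_graph_def by blast
  obtain y' e' where 2: "e' \<longlonglongrightarrow> 0" "\<And>n. 0 \<le> e' n" "\<And>n. approx_min (e' n) x' (y' n)"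
    "\<And>z. (\<lambda>n. pair (A (x' - y' n)) z) \<longlonglongrightarrow> pair c' z"
    using assms(2) unfolding par_graph_def by blast
  have "(\<lambda>n. pair (A (x + x' - (y n + y' n))) z) \<longlonglongrightarrow> pair (c + c') z" for z
    using tendsto_add[OF 1(4) 2(4), of z]
    by (simp add: a.diff_left a.add_left pair_add_left algebra_simps)
  moreover have "(\<lambda>n. e n + e' n) \<longlonglongrightarrow> 0"
    using tendsto_add[OF 1(1) 2(1)] by simp
  ultimately show ?thesis
    unfolding par_graph_def using 1(2,3) 2(2,3) approx_min_add
    by (intro exI[of _ "\<lambda>n. y n + y' n"] exI[of _ "\<lambda>n. e n + e' n"]) simp
qed

lemma par_graph_scale:
  assumes "par_graph x c"
  shows "par_graph (scaleE k x) (scaleF k c)"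
proof -
  obtain y e where 1: "e \<longlonglongrightarrow> 0" "\<And>n. 0 \<le> e n" "\<And>n. approx_min (e n) x (y n)"
    "\<And>z. (\<lambda>n. pair (A (x - y n)) z) \<longlonglongrightarrow> pair c z"
    using assms(1) unfolding par_graph_def by blast
  have "(\<lambda>n. pair (A (scaleE k x - scaleE k (y n))) z) \<longlonglongrightarrow> pair (scaleF k c) z" for z
    using tendsto_mult_left[OF 1(4), of k z]
    by (simp add: a.diff_left a.scale_left pair_scale_left right_diff_distrib)
  moreover have "(\<lambda>n. cmod k * e n) \<longlonglongrightarrow> 0"
    using tendsto_mult_left[OF 1(1), of "cmod k"] by simp
  ultimately show ?thesis
    unfolding par_graph_def using 1(2,3) approx_min_scale
    by (intro exI[of _ "\<lambda>n. scaleE k (y n)"] exI[of _ "\<lambda>n. cmod k * e n"]) simp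
qed

text \<open>The error bound of \<open>approx_min_par_form\<close> tends to 0 along the sequence, so
  the limit on the diagonal is the infimum of the energy.\<close>

lemma par_graph_diagonal:
  assumes "par_graph x c"
  shows "pair c x = of_real (par_form x)"
proof -
  obtain y e where 1: "e \<longlonglongrightarrow> 0" "\<And>n. 0 \<le> e n" "\<And>n. approx_min (e n) x (y n)"
    "\<And>z. (\<lambda>n. pair (A (x - y n)) z) \<longlonglongrightarrow> pair c z"
    using assms(1) unfolding par_graph_def by blast
  let ?K = "a.snorm x"
  have "(\<lambda>n. e n * (?K + e n) + (e n)\<^sup>2) \<longlonglongrightarrow> 0 * (?K + 0) + 0\<^sup>2"
    by (intro tendsto_intros 1)
  then have bound: "(\<lambda>n. e n * (?K + e n) + (e n)\<^sup>2) \<longlonglongrightarrow> 0"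
    by simp
  have "(\<lambda>n. pair (A (x - y n)) x - of_real (par_form x)) \<longlonglongrightarrow> 0"
    by (rule Lim_null_comparison[OF always_eventually bound]) (intro allI approx_min_par_form 1)
  moreover have "(\<lambda>n. pair (A (x - y n)) x - of_real (par_form x))
      \<longlonglongrightarrow> pair c x - of_real (par_form x)"
    by (intro tendsto_intros 1)
  ultimately show ?thesis
    using LIMSEQ_unique by fastforce
qed

lemma par_graph_zero:
  assumes "par_graph 0 c"
  shows "c = 0"
proof (rule eq_if_pair_eq)
  fix z
  obtain y e where 1: "e \<longlonglongrightarrow> 0" "\<And>n. 0 \<le> e n" "\<And>n. approx_min (e n) 0 (y n)"
    "\<And>z. (\<lambda>n. pair (A (0 - y n)) z) \<longlonglongrightarrow> pair c z"
    using assms(1) unfolding par_graph_def by blast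
  \<comment> \<open>For \<open>x = 0\<close> the point \<open>0\<close> is an exact minimiser; every
    other sequence is compared with it.\<close>
  have exact: "approx_min 0 0 0"
    by (simp add: approx_min_def)
  have bound: "(\<lambda>n. e n * a.snorm z) \<longlonglongrightarrow> 0"
    by (intro tendsto_mult_left_zero 1)
  have "cmod (pair (A (0 - y n)) z) \<le> e n * a.snorm z" for n
    using approx_min_cauchy[OF exact 1(3)[of n], of z] 1(2)[of n] by simp
  then have "(\<lambda>n. pair (A (0 - y n)) z) \<longlonglongrightarrow> 0"
    by (intro Lim_null_comparison[OF always_eventually bound] allI)
  then show "pair c z = pair 0 z"
    using 1(4) LIMSEQ_unique by fastforce
qed

text \<open>Linearity of the relation reduces uniqueness to the fibre over \<open>0\<close>.\<close>

lemma par_graph_unique: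
  assumes "par_graph x c" "par_graph x c'"
  shows "c = c'"
proof -
  have "par_graph (x + scaleE (-1) x) (c + scaleF (-1) c')"
    by (intro par_graph_add par_graph_scale assms)
  then have "par_graph 0 (c - c')"
    by simp
  then show ?thesis
    using par_graph_zero by fastforce
qed

definition par :: "'e \<Rightarrow> 'f" where
  "par x = (THE c. par_graph x c)"

lemma par_graph_par: "par_graph x (par x)"
proof -
  obtain c where "par_graph x c"
    using par_graph_exists ..
  moreover from this have "c' = c" if "par_graph x c'" for c'
    using that by (rule par_graph_unique[rotated])
  ultimately show ?thesis
    unfolding par_def by (rule theI)
qed

lemma par_eqI: "par_graph x c \<Longrightarrow> par x = c"
  by (rule par_graph_unique[OF par_graph_par])

lemma linear_par: "Vector_Spaces.linear scaleE scaleF par"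
proof unfold_locales
  show "par (x + y) = par x + par y" for x y
    by (intro par_eqI par_graph_add par_graph_par)
  show "par (scaleE k x) = scaleF k (par x)" for k x
    by (intro par_eqI par_graph_scale par_graph_par)
qed

lemma pair_par: "pair (par x) x = of_real (par_form x)"
  by (rule par_graph_diagonal[OF par_graph_par])

lemma positive_par: "positive_operator pair par"
  unfolding positive_operator_def pair_par
  using par_form_greatest[OF energy_nonneg] by simp

end

theorem theorem4p1:
  fixes scaleF :: "complex \<Rightarrow> 'f::ab_group_add \<Rightarrow> 'f"
    and scaleE :: "complex \<Rightarrow> 'e::ab_group_add \<Rightarrow> 'e"
    and pair :: "'f \<Rightarrow> 'e \<Rightarrow> complex"
    and A B :: "'e \<Rightarrow> 'f"
  assumes "anti_dual_pair scaleF scaleE pair"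
    and "weak_star_sequentially_complete pair"
    and "A \<in> weakly_continuous_operators scaleF scaleE pair" and "positive_operator pair A"
    and "B \<in> weakly_continuous_operators scaleF scaleE pair" and "positive_operator pair B"
  shows "\<exists>!C. C \<in> weakly_continuous_operators scaleF scaleE pair \<and> positive_operator pair C \<and>
    (\<forall>x. pair (C x) x =
      complex_of_real (INF y. Re (pair (A (x - y)) (x - y) + pair (B y) y)))"
proof -
  interpret anti_dual_pair scaleF scaleE pair by fact
  interpret parallel_sum scaleF scaleE pair A B
    using assms unfolding weakly_continuous_operators_def
    by (intro parallel_sum.intro parallel_sum_axioms.intro) simp_all
  have diagonal: "pair (par x) x =
      complex_of_real (INF y. Re (pair (A (x - y)) (x - y) + pair (B y) y))" for x
    by (simp only: pair_par par_form_def energy_def)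
  show ?thesis
  proof (rule ex1I[of _ par], intro conjI allI)
    show "par \<in> weakly_continuous_operators scaleF scaleE pair"
      by (rule positive_operator_weakly_continuous[OF linear_par positive_par])
  next
    fix C assume C: "C \<in> weakly_continuous_operators scaleF scaleE pair \<and> positive_operator pair C \<and>
      (\<forall>x. pair (C x) x =
        complex_of_real (INF y. Re (pair (A (x - y)) (x - y) + pair (B y) y)))"
    show "C = par"
    \<comment> \<open>Uniqueness: the prescribed infimum fixes the diagonal, and the diagonal
      determines a linear operator.\<close>
    proof (rule linear_eqI[OF _ linear_par])
      show "Vector_Spaces.linear scaleE scaleF C"
        using C unfolding weakly_continuous_operators_def by blast
      show "pair (C x) x = pair (par x) x" for x
        unfolding diagonal using C by blast
    qed
  qed (rule positive_par diagonal)+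
qed

end
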